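(* Let $M$ be an infinite metric space (with an arbitrary distinguished base point $0\in M$). Then $\mathcal F(M)$ does not have the fixed point property.
   Context: All Banach spaces are real. Let $(M,\rho,0)$ be a pointed metric space, i.e. a metric space with a distinguished base point $0\in M$. $\mathrm{Lip}_0(M)$ is the Banach space of all real-valued Lipschitz functions $f$ on $M$ with $f(0)=0$, equipped with the norm $\|f\|_{\mathrm{Lip}}=\sup\left\{\frac{|f(x)-f(y)|}{\rho(x,y)} : x,y\in M,\ x\neq y\right\}$. For $x\in M$ let $\delta_x\in \mathrm{Lip}_0(M)^*$ be the evaluation functional $\langle\delta_x,f\rangle=f(x)$. The Lipschitz-free space $\mathcal F(M)$ is the closed linear span of $\{\delta_x : x\in M\}$ in $\mathrm{Lip}_0(M)^*$, with the dual norm. A Banach space $X$ has the fixed point property if for every nonempty closed bounded convex set $C\subset X$, every nonexpansive (i.e. $1$-Lipschitz) map $T\colon C\to C$ has a fixed point. *)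

theory Defs
  imports "HOL-Analysis.Analysis"
begin

class pointed_metric_space = metric_space +
  fixes base_point :: 'a


typedef (overloaded) ('a::pointed_metric_space) lip0 =
  "{f :: 'a \<Rightarrow> real. f base_point = 0 \<and> (\<exists>L. L-lipschitz_on UNIV f)}"
  morphisms lip0_apply Lip0
  by (rule exI[of _ "\<lambda>_. 0"]) (auto intro!: exI[of _ 0] simp: lipschitz_on_def)

setup_lifting type_definition_lip0

text \<open>The element 0 is inserted so that the supremum is also meaningful (and equal to 0)
  for a one-point space; it does not affect the value otherwise.\<close>

definition lip_norm :: "('a::metric_space \<Rightarrow> real) \<Rightarrow> real" where
  "lip_norm f = Sup (insert 0 {\<bar>f x - f y\<bar> / dist x y | x y. x \<noteq> y})"

lemma lip_quotient_bdd_above: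
  fixes f :: "'a::metric_space \<Rightarrow> real"
  assumes "L-lipschitz_on UNIV f"
  shows "bdd_above (insert 0 {\<bar>f x - f y\<bar> / dist x y | x y. x \<noteq> y})"
proof (rule bdd_aboveI[of _ L])
  fix q assume "q \<in> insert 0 {\<bar>f x - f y\<bar> / dist x y | x y. x \<noteq> y}"
  then show "q \<le> L"
    using lipschitz_onD[OF assms] lipschitz_on_nonneg[OF assms]
    by (auto simp: dist_real_def divide_le_eq)
qed

lemma lip_norm_nonneg:
  fixes f :: "'a::metric_space \<Rightarrow> real"
  assumes "L-lipschitz_on UNIV f"
  shows "0 \<le> lip_norm f"
  unfolding lip_norm_def by (rule cSup_upper[OF _ lip_quotient_bdd_above[OF assms]]) simp

lemma lip_norm_bound:
  fixes f :: "'a::metric_space \<Rightarrow> real"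
  assumes "L-lipschitz_on UNIV f"
  shows "\<bar>f x - f y\<bar> \<le> lip_norm f * dist x y"
proof (cases "x = y")
  case False
  then have "\<bar>f x - f y\<bar> / dist x y \<le> lip_norm f"
    unfolding lip_norm_def by (intro cSup_upper[OF _ lip_quotient_bdd_above[OF assms]]) auto
  with False show ?thesis by (simp add: divide_le_eq)
qed simp

lemma lip_norm_least:
  fixes f :: "'a::metric_space \<Rightarrow> real"
  assumes "0 \<le> c" "\<And>x y. \<bar>f x - f y\<bar> \<le> c * dist x y"
  shows "lip_norm f \<le> c"
  unfolding lip_norm_def using assms by (intro cSup_least) (auto simp: divide_le_eq)

lemma lip_norm_scale_le:
  fixes f :: "'a::metric_space \<Rightarrow> real"
  assumes "L-lipschitz_on UNIV f"
  shows "lip_norm (\<lambda>x. a * f x) \<le> \<bar>a\<bar> * lip_norm f"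
proof (rule lip_norm_least)
  fix x y
  have "\<bar>a * f x - a * f y\<bar> = \<bar>a\<bar> * \<bar>f x - f y\<bar>"
    by (simp add: abs_mult flip: right_diff_distrib)
  also have "\<dots> \<le> \<bar>a\<bar> * (lip_norm f * dist x y)"
    by (intro mult_left_mono lip_norm_bound[OF assms]) simp
  finally show "\<bar>a * f x - a * f y\<bar> \<le> \<bar>a\<bar> * lip_norm f * dist x y"
    by (simp add: mult.assoc)
qed (simp add: lip_norm_nonneg[OF assms])

instantiation lip0 :: (pointed_metric_space) real_vector
begin

lift_definition zero_lip0 :: "'a lip0" is "\<lambda>_. 0"
  by (auto intro!: exI[of _ 0] simp: lipschitz_on_def)

lift_definition plus_lip0 :: "'a lip0 \<Rightarrow> 'a lip0 \<Rightarrow> 'a lip0" is "\<lambda>f g x. f x + g x"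
  by (auto intro: lipschitz_on_add)

lift_definition minus_lip0 :: "'a lip0 \<Rightarrow> 'a lip0 \<Rightarrow> 'a lip0" is "\<lambda>f g x. f x - g x"
  by (auto intro: lipschitz_on_diff)

lift_definition uminus_lip0 :: "'a lip0 \<Rightarrow> 'a lip0" is "\<lambda>f x. - f x"
  by (auto intro: lipschitz_on_minus)

lift_definition scaleR_lip0 :: "real \<Rightarrow> 'a lip0 \<Rightarrow> 'a lip0" is "\<lambda>a f x. a * f x"
  by (auto intro: lipschitz_on_cmult_real)

instance
  by standard (transfer; simp add: algebra_simps fun_eq_iff)+

end

instantiation lip0 :: (pointed_metric_space) real_normed_vector
begin

lift_definition norm_lip0 :: "'a lip0 \<Rightarrow> real" is lip_norm .

definition "dist_lip0 (f :: 'a lip0) g = norm (f - g)"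
definition "sgn_lip0 (f :: 'a lip0) = f /\<^sub>R norm f"
definition [code del]: "(uniformity :: ('a lip0 \<times> 'a lip0) filter) =
  (INF e\<in>{0<..}. principal {(f, g). dist f g < e})"
definition [code del]: "open (U :: 'a lip0 set) \<longleftrightarrow>
  (\<forall>f\<in>U. \<forall>\<^sub>F (f', g) in uniformity. f' = f \<longrightarrow> g \<in> U)"

instance
proof
  fix f g :: "'a lip0" and a :: real and U :: "'a lip0 set"
  show "dist f g = norm (f - g)" by (rule dist_lip0_def)
  show "sgn f = f /\<^sub>R norm f" by (rule sgn_lip0_def)
  show "(uniformity :: ('a lip0 \<times> 'a lip0) filter) =
      (INF e\<in>{0<..}. principal {(f, g). dist f g < e})" by (rule uniformity_lip0_def)
  show "open U \<longleftrightarrow> (\<forall>f\<in>U. \<forall>\<^sub>F (f', g) in uniformity. f' = f \<longrightarrow> g \<in> U)"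
    by (rule open_lip0_def)
  show "norm f = 0 \<longleftrightarrow> f = 0"
  proof
    assume "norm f = 0"
    then show "f = 0"
    proof transfer
      fix f :: "'a \<Rightarrow> real"
      assume f: "f base_point = 0 \<and> (\<exists>L. L-lipschitz_on UNIV f)" and "lip_norm f = 0"
      then obtain L where "L-lipschitz_on UNIV f" by blast
      from lip_norm_bound[OF this] \<open>lip_norm f = 0\<close> have "f x = f base_point" for x
        by fastforce
      with f show "f = (\<lambda>_. 0)" by auto
    qed
  next
    assume "f = 0"
    then show "norm f = 0"
    proof (simp, transfer)
      have z: "0-lipschitz_on UNIV (\<lambda>_::'a. 0::real)" by (simp add: lipschitz_on_def)
      show "lip_norm (\<lambda>_::'a. 0) = 0"
        using lip_norm_nonneg[OF z] lip_norm_least[of 0 "\<lambda>_::'a. 0"] by simp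
    qed
  qed
  show "norm (f + g) \<le> norm f + norm g"
  proof transfer
    fix f g :: "'a \<Rightarrow> real"
    assume "f base_point = 0 \<and> (\<exists>L. L-lipschitz_on UNIV f)"
      and "g base_point = 0 \<and> (\<exists>L. L-lipschitz_on UNIV g)"
    then obtain K L where f: "K-lipschitz_on UNIV f" and g: "L-lipschitz_on UNIV g" by blast
    show "lip_norm (\<lambda>x. f x + g x) \<le> lip_norm f + lip_norm g"
    proof (rule lip_norm_least)
      fix x y
      show "\<bar>f x + g x - (f y + g y)\<bar> \<le> (lip_norm f + lip_norm g) * dist x y"
        using lip_norm_bound[OF f, of x y] lip_norm_bound[OF g, of x y]
        by (simp add: distrib_right)
    qed (simp add: lip_norm_nonneg[OF f] lip_norm_nonneg[OF g])
  qed
  show "norm (a *\<^sub>R f) = \<bar>a\<bar> * norm f"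
  proof transfer
    fix a and f :: "'a \<Rightarrow> real"
    assume "f base_point = 0 \<and> (\<exists>L. L-lipschitz_on UNIV f)"
    then obtain L where f: "L-lipschitz_on UNIV f" by blast
    then have af: "(\<bar>a\<bar> * L)-lipschitz_on UNIV (\<lambda>x. a * f x)"
      by (rule lipschitz_on_cmult_real)
    show "lip_norm (\<lambda>x. a * f x) = \<bar>a\<bar> * lip_norm f"
    proof (cases "a = 0")
      case True
      then show ?thesis
        using lip_norm_scale_le[OF f, of a] lip_norm_nonneg[OF af] by simp
    next
      case False
      then have "lip_norm f \<le> \<bar>inverse a\<bar> * lip_norm (\<lambda>x. a * f x)"
        using lip_norm_scale_le[OF af, of "inverse a"] by (simp flip: mult.assoc)
      with False have "\<bar>a\<bar> * lip_norm f \<le> lip_norm (\<lambda>x. a * f x)"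
        by (simp add: field_simps)
      with lip_norm_scale_le[OF f, of a] show ?thesis by simp
    qed
  qed
qed

end


lift_definition lip0_eval :: "'a::pointed_metric_space \<Rightarrow> 'a lip0 \<Rightarrow>\<^sub>L real"
  is "\<lambda>x f. lip0_apply f x"
proof
  fix x :: 'a and f g :: "'a lip0" and r :: real
  show "lip0_apply (f + g) x = lip0_apply f x + lip0_apply g x" by transfer simp
  show "lip0_apply (r *\<^sub>R f) x = r *\<^sub>R lip0_apply f x" by transfer simp
  have "norm (lip0_apply f x) \<le> norm f * dist x base_point" for f
  proof transfer
    fix f :: "'a \<Rightarrow> real" and x
    assume f: "f base_point = 0 \<and> (\<exists>L. L-lipschitz_on UNIV f)"
    then obtain L where "L-lipschitz_on UNIV f" by blast
    from lip_norm_bound[OF this, of x base_point] f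
    show "norm (f x) \<le> lip_norm f * dist x base_point" by simp
  qed
  then show "\<exists>K. \<forall>f. norm (lip0_apply f x) \<le> norm f * K" by blast
qed

text \<open>The dual of the normed space of type \<open>'a lip0\<close> is the type \<open>'a lip0 \<Rightarrow>\<^sub>L real\<close>, whose norm is
  the operator norm. The free space is a closed linear subspace of it.\<close>

definition lipschitz_free :: "('a::pointed_metric_space lip0 \<Rightarrow>\<^sub>L real) set" where
  "lipschitz_free = closure (span (range lip0_eval))"


text \<open>The Banach space is given as a closed linear subspace \<open>X\<close> of some normed space; for subsets
  of such an \<open>X\<close>, closedness in \<open>X\<close> and in the ambient space agree.\<close>

definition fixed_point_property :: "'b::real_normed_vector set \<Rightarrow> bool" where
  "fixed_point_property X \<longleftrightarrow>
    (\<forall>C T. C \<subseteq> X \<longrightarrow> C \<noteq> {} \<longrightarrow> closed C \<longrightarrow> bounded C \<longrightarrow> convex C \<longrightarrow>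
       T ` C \<subseteq> C \<longrightarrow> 1-lipschitz_on C T \<longrightarrow> (\<exists>x\<in>C. T x = x))"

end

theory Submission
  imports Defs
begin

text \<open>Let \<open>\<delta>\<^sub>x\<close> denote evaluation at \<open>x\<close>, and call \<open>(\<delta>\<^sub>x - \<delta>\<^sub>y) / dist x y\<close> the molecule of the pair
  \<open>x, y\<close>; its norm is at most 1. The theorem holds because the free space over an infinite metric
  space contains an asymptotically isometric copy of \<open>\<ell>\<^sub>1\<close> spanned by molecules, and such a copy
  defeats the fixed point property.

  The second fact is due to Dowling and Lennard. If the vectors of the copy are given suitable
  weights decreasing to 1, then the right shift becomes a nonexpansive self-map of their closed
  convex hull, and it has no fixed point because the coefficients of a convex combination cannot
  be invariant under the shift (\<open>fixed_point_property_fails_by_shift\<close>).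

  For the first fact, suppose that disjoint balls are centred at points \<open>z 0, z 1, \<dots>\<close> and that the
  balls at \<open>z (2 * n)\<close> and \<open>z (2 * n + 1)\<close> nearly touch. A function whose absolute value at
  each centre is the radius is 1-Lipschitz on the centres for every choice of signs, and extends to the
  whole space. Taking opposite signs at partners, one obtains a functional of norm at most 1 that is
  almost 1 in modulus, with an arbitrary sign, at each of the molecules of the partner pairs. That is the
  lower \<open>\<ell>\<^sub>1\<close> estimate (\<open>paired_balls_imp_not_fixed_point_property\<close>).

  Such balls exist in every infinite metric space. If the space is unbounded, some sequence
  recedes from a given point so fast that each new distance dwarfs the previous ones. If it is
  bounded, a compactness argument yields a sequence of distinct points whose mutual distances
  converge to a number \<open>r\<close>. For \<open>r = 0\<close> the sequence is Cauchy, and a subsequence approaches its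
  limit in the completion as fast as desired; this is the unbounded case turned inside out
  (\<open>paired_balls_lacunary\<close>). For \<open>r > 0\<close> a subsequence is almost equilateral and balls of radius
  slightly below \<open>r / 2\<close> will do (\<open>paired_balls_almost_equilateral\<close>).\<close>

section \<open>Shifts on sequences equivalent to the basis of \<open>\<ell>\<^sub>1\<close>\<close>

lemma coefficient_bound_suminf:
  fixes y :: "nat \<Rightarrow> 'b::banach"
  assumes lower: "\<And>t N. c * (\<Sum>k<N. \<bar>t k\<bar>) \<le> norm (\<Sum>k<N. t k *\<^sub>R y k)"
    and c: "c \<ge> 0" and t: "summable (\<lambda>k. t k *\<^sub>R y k)"
  shows "c * (\<Sum>k<N. \<bar>t k\<bar>) \<le> norm (\<Sum>k. t k *\<^sub>R y k)"
proof (rule LIMSEQ_le_const)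
  show "(\<lambda>n. norm (\<Sum>k<n. t k *\<^sub>R y k)) \<longlonglongrightarrow> norm (\<Sum>k. t k *\<^sub>R y k)"
    by (intro tendsto_norm summable_LIMSEQ t)
  show "\<exists>n0. \<forall>n\<ge>n0. c * (\<Sum>k<N. \<bar>t k\<bar>) \<le> norm (\<Sum>k<n. t k *\<^sub>R y k)"
  proof (intro exI[of _ N] allI impI)
    fix n assume "N \<le> n"
    then have "c * (\<Sum>k<N. \<bar>t k\<bar>) \<le> c * (\<Sum>k<n. \<bar>t k\<bar>)"
      by (intro mult_left_mono sum_mono2 c) auto
    with lower[of t n] show "c * (\<Sum>k<N. \<bar>t k\<bar>) \<le> norm (\<Sum>k<n. t k *\<^sub>R y k)" by linarith
  qed
qed

lemma summable_scaleR_bounded: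
  fixes y :: "nat \<Rightarrow> 'b::banach"
  assumes K: "\<And>k. norm (y k) \<le> K" and t: "summable (\<lambda>k. \<bar>t k\<bar>)"
  shows "summable (\<lambda>k. t k *\<^sub>R y k)"
    and "norm (\<Sum>k. t k *\<^sub>R y k) \<le> K * (\<Sum>k. \<bar>t k\<bar>)"
proof -
  have le: "norm (t k *\<^sub>R y k) \<le> K * \<bar>t k\<bar>" for k
    using mult_left_mono[OF K[of k], of "\<bar>t k\<bar>"] by (simp add: mult.commute)
  have s: "summable (\<lambda>k. K * \<bar>t k\<bar>)" using t by (rule summable_mult)
  show "summable (\<lambda>k. t k *\<^sub>R y k)"
    by (rule summable_comparison_test'[OF s, of 0]) (rule le)
  have "norm (\<Sum>k. t k *\<^sub>R y k) \<le> (\<Sum>k. K * \<bar>t k\<bar>)"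
    by (rule norm_suminf_le[OF le s])
  then show "norm (\<Sum>k. t k *\<^sub>R y k) \<le> K * (\<Sum>k. \<bar>t k\<bar>)"
    using suminf_mult[OF t, of K] by simp
qed

lemma abs_suminf_diff_le:
  fixes s t :: "nat \<Rightarrow> real"
  assumes "summable (\<lambda>k. \<bar>s k - t k\<bar>)" "summable s" "summable t"
  shows "\<bar>suminf s - suminf t\<bar> \<le> (\<Sum>k. \<bar>s k - t k\<bar>)"
  using summable_rabs[OF assms(1)] suminf_diff[OF assms(2,3)] by simp

text \<open>The lower bound makes the synthesis map \<open>t \<mapsto> (\<Sum>k. t k *\<^sub>R y k)\<close> an isomorphic embedding
  of \<open>\<ell>\<^sub>1\<close>, and the simplex is closed in \<open>\<ell>\<^sub>1\<close>: no mass can escape to infinity under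
  convergence in the \<open>\<ell>\<^sub>1\<close> norm, although it can under coordinatewise convergence. The proof
  therefore takes coordinatewise limits of the coefficients and then upgrades the convergence to
  \<open>\<ell>\<^sub>1\<close> by passing to the limit in the estimate for two members of the sequence.\<close>
lemma closed_simplex_image:
  fixes y :: "nat \<Rightarrow> 'b::banach"
  assumes K: "\<And>k. norm (y k) \<le> K" and c: "c > 0"
    and lower: "\<And>t N. c * (\<Sum>k<N. \<bar>t k\<bar>) \<le> norm (\<Sum>k<N. t k *\<^sub>R y k)"
  shows "closed ((\<lambda>t. \<Sum>k. t k *\<^sub>R y k) ` {t. (\<forall>k. 0 \<le> t k) \<and> t sums 1})"
    (is "closed (?S ` ?D)")
proof -
  have abs_D: "summable (\<lambda>k. \<bar>t k\<bar>)" if "t \<in> ?D" for t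
    using that by (auto simp: sums_iff)
  note sum_D = summable_scaleR_bounded[where y = y, OF K abs_D]
  have S_diff: "?S s - ?S t = ?S (\<lambda>k. s k - t k)"
    and sum_diff: "summable (\<lambda>k. (s k - t k) *\<^sub>R y k)" if "s \<in> ?D" "t \<in> ?D" for s t
    using suminf_diff[OF sum_D(1)[OF that(1)] sum_D(1)[OF that(2)]]
      summable_diff[OF sum_D(1)[OF that(1)] sum_D(1)[OF that(2)]]
    by (simp_all add: scaleR_left_diff_distrib)
  have l1: "c * (\<Sum>k<N. \<bar>s k - t k\<bar>) \<le> norm (?S s - ?S t)" if "s \<in> ?D" "t \<in> ?D" for s t N
    unfolding S_diff[OF that]
    using c by (intro coefficient_bound_suminf[OF lower] sum_diff that) auto
  have "x \<in> ?S ` ?D" if x: "\<And>m. X m \<in> ?S ` ?D" "X \<longlonglongrightarrow> x" for X x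
  proof -
    from x(1) have "\<forall>m. \<exists>t. t \<in> ?D \<and> X m = ?S t" by blast
    then obtain t where tD: "\<And>m. t m \<in> ?D" and X: "\<And>m. X m = ?S (t m)" by metis
    have "convergent (\<lambda>m. t m k)" for k
    proof -
      have "c * \<bar>t m k - t n k\<bar> \<le> norm (X m - X n)" for m n
      proof -
        have "\<bar>t m k - t n k\<bar> \<le> (\<Sum>i<Suc k. \<bar>t m i - t n i\<bar>)"
          by (rule member_le_sum) auto
        then have "c * \<bar>t m k - t n k\<bar> \<le> c * (\<Sum>i<Suc k. \<bar>t m i - t n i\<bar>)"
          using c by (intro mult_left_mono) auto
        with l1[OF tD[of m] tD[of n], of "Suc k"] show ?thesis unfolding X by linarith
      qed
      note coord = this
      have "Cauchy (\<lambda>m. t m k)"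
      proof (rule metric_CauchyI)
        fix e :: real assume "e > 0"
        then have "c * e > 0" using c by simp
        with LIMSEQ_imp_Cauchy[OF x(2)] obtain M
          where M: "\<And>m n. m \<ge> M \<Longrightarrow> n \<ge> M \<Longrightarrow> dist (X m) (X n) < c * e"
          unfolding Cauchy_def by blast
        have "dist (t m k) (t n k) < e" if "m \<ge> M" "n \<ge> M" for m n
        proof -
          have "c * \<bar>t m k - t n k\<bar> < c * e"
            using coord[of m n] M[OF that] by (simp add: dist_norm)
          with c show ?thesis by (simp add: dist_real_def)
        qed
        then show "\<exists>M. \<forall>m\<ge>M. \<forall>n\<ge>M. dist (t m k) (t n k) < e" by blast
      qed
      then show ?thesis by (rule Cauchy_convergent)
    qed
    then obtain \<tau> where \<tau>: "\<And>k. (\<lambda>m. t m k) \<longlonglongrightarrow> \<tau> k" unfolding convergent_def by metis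
    \<comment> \<open>Letting the second index tend to infinity gives an \<open>\<ell>\<^sub>1\<close> bound uniform in \<open>N\<close>.\<close>
    have tail: "c * (\<Sum>k<N. \<bar>t m k - \<tau> k\<bar>) \<le> norm (X m - x)" for m N
    proof (rule LIMSEQ_le)
      show "(\<lambda>n. c * (\<Sum>k<N. \<bar>t m k - t n k\<bar>)) \<longlonglongrightarrow> c * (\<Sum>k<N. \<bar>t m k - \<tau> k\<bar>)"
        by (intro tendsto_intros \<tau>)
      show "(\<lambda>n. norm (X m - X n)) \<longlonglongrightarrow> norm (X m - x)"
        by (intro tendsto_intros x)
      show "\<exists>N'. \<forall>n\<ge>N'. c * (\<Sum>k<N. \<bar>t m k - t n k\<bar>) \<le> norm (X m - X n)"
        using l1[OF tD[of m] tD] unfolding X by blast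
    qed
    then have tail': "(\<Sum>k<N. \<bar>t m k - \<tau> k\<bar>) \<le> norm (X m - x) / c" for m N
      using c by (simp add: field_simps)
    have sd: "summable (\<lambda>k. \<bar>t m k - \<tau> k\<bar>)" for m
      by (rule bounded_imp_summable[where B = "norm (X m - x) / c"])
        (use tail'[of m "Suc _"] in \<open>auto simp: lessThan_Suc_atMost\<close>)
    have sd_le: "(\<Sum>k. \<bar>t m k - \<tau> k\<bar>) \<le> norm (X m - x) / c" for m
      by (rule suminf_le_const[OF sd tail'])
    have lim0: "(\<lambda>m. norm (X m - x) / c) \<longlonglongrightarrow> 0"
      using tendsto_divide[OF tendsto_norm_zero[OF LIM_zero[OF x(2)]] tendsto_const[of c]] c by simp
    have t_sum: "summable (t m)" "suminf (t m) = 1" for m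
      using tD[of m] by (auto simp: sums_iff)
    have \<tau>_sum: "summable \<tau>"
      using summable_diff[OF t_sum(1)[of 0] summable_rabs_cancel[OF sd[of 0]]] by simp
    have \<tau>_pos: "0 \<le> \<tau> k" for k
      by (rule LIMSEQ_le_const[OF \<tau>]) (use tD in auto)
    have "(\<lambda>m. suminf (t m) - suminf \<tau>) \<longlonglongrightarrow> 0"
    proof (rule tendsto_rabs_zero_cancel, rule tendsto_sandwich[OF _ _ tendsto_const lim0])
      show "\<forall>\<^sub>F m in sequentially. \<bar>suminf (t m) - suminf \<tau>\<bar> \<le> norm (X m - x) / c"
        using order_trans[OF abs_suminf_diff_le[OF sd t_sum(1) \<tau>_sum] sd_le] by simp
    qed simp
    then have "suminf \<tau> = 1"
      unfolding t_sum(2) by (simp add: LIMSEQ_const_iff)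
    then have \<tau>D: "\<tau> \<in> ?D" using \<tau>_sum \<tau>_pos by (auto simp: sums_iff)
    have "X \<longlonglongrightarrow> ?S \<tau>"
    proof (rule LIM_zero_cancel, rule tendsto_norm_zero_cancel,
        rule tendsto_sandwich[OF _ _ tendsto_const])
      show "\<forall>\<^sub>F m in sequentially. norm (X m - ?S \<tau>) \<le> K * (norm (X m - x) / c)"
      proof (rule always_eventually, rule allI)
        fix m
        have "norm (X m - ?S \<tau>) \<le> K * (\<Sum>k. \<bar>t m k - \<tau> k\<bar>)"
          unfolding X S_diff[OF tD \<tau>D] by (rule summable_scaleR_bounded[OF K sd])
        also have "\<dots> \<le> K * (norm (X m - x) / c)"
          using order_trans[OF norm_ge_zero K] by (intro mult_left_mono sd_le) auto
        finally show "norm (X m - ?S \<tau>) \<le> K * (norm (X m - x) / c)" .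
      qed
      show "(\<lambda>m. K * (norm (X m - x) / c)) \<longlonglongrightarrow> 0"
        using tendsto_mult[OF tendsto_const[of K] lim0] by simp
    qed simp
    with x(2) have "x = ?S \<tau>" by (rule LIMSEQ_unique)
    with \<tau>D show ?thesis by blast
  qed
  then show ?thesis unfolding closed_sequential_limits by blast
qed

text \<open>The Dowling--Lennard argument. On the set \<open>C\<close> of all infinite convex combinations of the
  vectors \<open>y k\<close>, let \<open>T\<close> replace \<open>y k\<close> by \<open>y (Suc k)\<close>. The hypothesis on shifted sums
  makes \<open>T\<close> nonexpansive. Since the coefficients of a point of \<open>C\<close> are unique, a fixed point
  would have a coefficient sequence equal to its own right shift, hence zero; but the coefficients
  add up to 1.\<close>
lemma fixed_point_property_fails_by_shift:
  fixes y :: "nat \<Rightarrow> 'b::banach"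
  assumes X: "subspace X" "closed X" and yX: "\<And>k. y k \<in> X"
    and K: "\<And>k. norm (y k) \<le> K" and c: "c > 0"
    and lower: "\<And>t N. c * (\<Sum>k<N. \<bar>t k\<bar>) \<le> norm (\<Sum>k<N. t k *\<^sub>R y k)"
    and shift: "\<And>t N. norm (\<Sum>k<N. t k *\<^sub>R y (Suc k)) \<le> norm (\<Sum>k<N. t k *\<^sub>R y k)"
  shows "\<not> fixed_point_property X"
proof
  assume fpp: "fixed_point_property X"
  define D where "D = {t::nat \<Rightarrow> real. (\<forall>k. 0 \<le> t k) \<and> t sums 1}"
  define S where "S t = (\<Sum>k. t k *\<^sub>R y k)" for t
  define R :: "(nat \<Rightarrow> real) \<Rightarrow> nat \<Rightarrow> real" where "R t = case_nat 0 t" for t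
  define T where "T x = S (R (SOME t. t \<in> D \<and> S t = x))" for x
  have abs_D: "summable (\<lambda>k. \<bar>t k\<bar>)" if "t \<in> D" for t
    using that by (auto simp: sums_iff D_def)
  note sum_D = summable_scaleR_bounded[where y = y, OF K abs_D]
  have S_diff: "S s - S t = S (\<lambda>k. s k - t k)"
    and sum_diff: "summable (\<lambda>k. (s k - t k) *\<^sub>R y k)" if "s \<in> D" "t \<in> D" for s t
    using suminf_diff[OF sum_D(1)[OF that(1)] sum_D(1)[OF that(2)]]
      summable_diff[OF sum_D(1)[OF that(1)] sum_D(1)[OF that(2)]]
    by (simp_all add: scaleR_left_diff_distrib S_def)
  have inj: "s = t" if "s \<in> D" "t \<in> D" "S s = S t" for s t
  proof
    fix k
    have "c * (\<Sum>i<Suc k. \<bar>s i - t i\<bar>) \<le> norm (S s - S t)"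
      unfolding S_diff[OF that(1,2)] unfolding S_def
      using c by (intro coefficient_bound_suminf[OF lower] sum_diff that) auto
    with that c have "(\<Sum>i<Suc k. \<bar>s i - t i\<bar>) \<le> 0"
      by (simp add: mult_le_0_iff del: sum.lessThan_Suc)
    moreover have "\<bar>s k - t k\<bar> \<le> (\<Sum>i<Suc k. \<bar>s i - t i\<bar>)"
      by (rule member_le_sum) auto
    ultimately show "s k = t k" by linarith
  qed
  have T_S: "T (S t) = S (R t)" if "t \<in> D" for t
  proof -
    have "(SOME s. s \<in> D \<and> S s = S t) = t"
      by (rule some_equality) (use that inj in auto)
    then show ?thesis by (simp add: T_def)
  qed
  have R_D: "R t \<in> D" if "t \<in> D" for t
    using that sums_Suc_iff[of "R t" 1] by (auto simp: D_def R_def split: nat.split)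
  have S_R: "S (R s) - S (R t) = (\<Sum>k. (s k - t k) *\<^sub>R y (Suc k))"
    and sum_R: "summable (\<lambda>k. (s k - t k) *\<^sub>R y (Suc k))"
    if "s \<in> D" "t \<in> D" for s t
  proof -
    note R = R_D[OF that(1)] R_D[OF that(2)]
    show "summable (\<lambda>k. (s k - t k) *\<^sub>R y (Suc k))"
      using sum_diff[OF R] by (subst (asm) summable_Suc_iff[symmetric]) (simp add: R_def)
    show "S (R s) - S (R t) = (\<Sum>k. (s k - t k) *\<^sub>R y (Suc k))"
      unfolding S_diff[OF R] unfolding S_def using suminf_split_head[OF sum_diff[OF R]]
      by (simp add: R_def)
  qed
  have nonexp: "norm (S (R s) - S (R t)) \<le> norm (S s - S t)" if "s \<in> D" "t \<in> D" for s t
    unfolding S_R[OF that] S_diff[OF that] unfolding S_def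
    by (rule LIMSEQ_le[OF tendsto_norm[OF summable_LIMSEQ[OF sum_R[OF that]]]
          tendsto_norm[OF summable_LIMSEQ[OF sum_diff[OF that]]]])
      (use shift[of "\<lambda>k. s k - t k"] in blast)
  have "\<exists>x\<in>S ` D. T x = x"
  proof (rule fpp[unfolded fixed_point_property_def, rule_format])
    show "S ` D \<subseteq> X"
    proof (rule image_subsetI)
      fix t assume "t \<in> D"
      then have lim: "(\<lambda>n. \<Sum>k<n. t k *\<^sub>R y k) \<longlonglongrightarrow> S t"
        unfolding S_def by (intro summable_LIMSEQ sum_D)
      show "S t \<in> X"
        by (rule closed_sequentially[OF X(2) _ lim])
          (intro subspace_sum[OF X(1)] subspace_scale[OF X(1)] yX)
    qed
    have "(\<lambda>k. if k = 0 then 1 else 0) \<in> D"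
      using sums_single[of 0 "\<lambda>_. 1::real"] by (auto simp: D_def)
    then show "S ` D \<noteq> {}" by blast
    show "closed (S ` D)"
      using closed_simplex_image[OF K c lower] unfolding S_def D_def .
    show "bounded (S ` D)"
    proof (rule boundedI)
      fix x assume "x \<in> S ` D"
      then obtain t where t: "t \<in> D" "x = S t" by blast
      moreover from t have "(\<Sum>k. \<bar>t k\<bar>) = 1" by (auto simp: D_def sums_iff)
      ultimately show "norm x \<le> K" using sum_D(2)[OF t(1)] by (simp add: S_def)
    qed
    show "convex (S ` D)"
    proof (rule convexI, elim imageE)
      fix x z s t and u v :: real
      assume uv: "0 \<le> u" "0 \<le> v" "u + v = 1"
        and x: "x = S s" and s: "s \<in> D" and z: "z = S t" and t: "t \<in> D"
      let ?w = "\<lambda>k. u * s k + v * t k"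
      have "?w sums (u * 1 + v * 1)"
        using s t unfolding D_def by (intro sums_add sums_mult) auto
      moreover have "0 \<le> ?w k" for k
        using s t uv(1,2) unfolding D_def by (intro add_nonneg_nonneg mult_nonneg_nonneg) auto
      ultimately have "?w \<in> D" using uv(3) by (simp add: D_def)
      moreover have "(\<lambda>k. ?w k *\<^sub>R y k) sums (u *\<^sub>R S s + v *\<^sub>R S t)"
        unfolding scaleR_add_left scaleR_scaleR[symmetric] unfolding S_def
        by (intro sums_add sums_scaleR_right summable_sums sum_D(1)[OF s] sum_D(1)[OF t])
      then have "u *\<^sub>R x + v *\<^sub>R z = S ?w"
        unfolding x z unfolding S_def[of ?w] by (rule sums_unique)
      ultimately show "u *\<^sub>R x + v *\<^sub>R z \<in> S ` D" by (rule rev_image_eqI[of ?w D _ S])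
    qed
    show "T ` S ` D \<subseteq> S ` D"
    proof (clarify, rule image_eqI)
      fix t assume "t \<in> D"
      then show "T (S t) = S (R t)" "R t \<in> D" by (rule T_S, rule R_D)
    qed
    show "1-lipschitz_on (S ` D) T"
      by (rule lipschitz_onI) (use nonexp T_S in \<open>auto simp: dist_norm\<close>)
  qed
  then obtain t where t: "t \<in> D" "S (R t) = S t" using T_S by auto
  have eq: "R t k = t k" for k using inj[OF R_D[OF t(1)] t] by (rule fun_cong)
  have step: "t 0 = 0" "t (Suc k) = t k" for k
    using eq[of 0] eq[of "Suc k"] by (simp_all add: R_def)
  have "t k = 0" for k by (induction k) (simp_all add: step)
  then have "t = (\<lambda>_. 0)" by auto
  with t(1) have "(\<lambda>_. 0::real) sums 1" by (simp add: D_def)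
  from sums_unique2[OF sums_zero this] show False by simp
qed

section \<open>Lipschitz functions and evaluations\<close>

text \<open>The extension is the lower envelope \<open>g x = (INF a\<in>A. f a + L * dist a x)\<close> of the cones that
  bound \<open>f\<close> from above.\<close>
lemma mcshane_extension:
  fixes f :: "'a::metric_space \<Rightarrow> real"
  assumes f: "L-lipschitz_on A f"
  obtains g where "L-lipschitz_on UNIV g" "\<And>x. x \<in> A \<Longrightarrow> g x = f x"
proof (cases "A = {}")
  case True
  have "L-lipschitz_on UNIV (\<lambda>_::'a. 0::real)"
    using lipschitz_on_nonneg[OF f] by (auto intro: lipschitz_onI)
  then show thesis using that True by blast
next
  case False
  then obtain a0 where a0: "a0 \<in> A" by blast
  have L: "0 \<le> L" by (rule lipschitz_on_nonneg[OF f])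
  define g where "g x = (INF a\<in>A. f a + L * dist a x)" for x
  have bdd: "bdd_below ((\<lambda>a. f a + L * dist a x) ` A)" for x
  proof (rule bdd_belowI2)
    fix a assume "a \<in> A"
    then have "\<bar>f a0 - f a\<bar> \<le> L * dist a0 a"
      using lipschitz_onD[OF f a0] by (simp add: dist_real_def)
    also have "\<dots> \<le> L * (dist a0 x + dist a x)"
      by (intro mult_left_mono dist_triangle2 L)
    finally show "f a0 - L * dist a0 x \<le> f a + L * dist a x" by (simp add: distrib_left)
  qed
  have g_le: "g x \<le> g z + L * dist x z" for x z
  proof -
    have "g x - L * dist x z \<le> f a + L * dist a z" if "a \<in> A" for a
    proof -
      have "g x \<le> f a + L * dist a x"
        unfolding g_def by (rule cINF_lower[OF bdd that])
      also have "\<dots> \<le> f a + L * (dist a z + dist x z)"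
        by (intro add_left_mono mult_left_mono dist_triangle2 L)
      finally show ?thesis by (simp add: distrib_left)
    qed
    then have "g x - L * dist x z \<le> g z"
      unfolding g_def[of z] by (intro cINF_greatest False)
    then show ?thesis by simp
  qed
  have "L-lipschitz_on UNIV g"
  proof (rule lipschitz_onI[OF _ L])
    fix x z show "dist (g x) (g z) \<le> L * dist x z"
      using g_le[of x z] g_le[of z x] by (simp add: dist_real_def dist_commute)
  qed
  moreover have "g x = f x" if x: "x \<in> A" for x
  proof (rule antisym)
    show "g x \<le> f x" using cINF_lower[OF bdd x, of x] by (simp add: g_def)
    have "f x \<le> f a + L * dist a x" if "a \<in> A" for a
      using lipschitz_onD[OF f that x] by (simp add: dist_real_def)
    then show "f x \<le> g x" unfolding g_def by (intro cINF_greatest False)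
  qed
  ultimately show thesis using that by blast
qed

lemma lip0_eval_apply: "blinfun_apply (lip0_eval x) f = lip0_apply f x"
  by transfer simp

lemma norm_lip0_eval_diff_le: "norm (lip0_eval x - lip0_eval y) \<le> dist x y"
proof (rule norm_blinfun_bound)
  fix f :: "'a lip0"
  have "\<bar>lip0_apply f x - lip0_apply f y\<bar> \<le> norm f * dist x y"
    by transfer (use lip_norm_bound in blast)
  then show "norm (blinfun_apply (lip0_eval x - lip0_eval y) f) \<le> dist x y * norm f"
    by (simp add: blinfun.diff_left lip0_eval_apply mult.commute)
qed simp

text \<open>Elements of the free space built from differences of evaluations cannot see additive
  constants, so the normalisation at the base point costs nothing.\<close>
lemma lip0_of_lipschitz:
  fixes g :: "'a::pointed_metric_space \<Rightarrow> real"
  assumes g: "1-lipschitz_on UNIV g"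
  obtains f :: "'a lip0" where "norm f \<le> 1"
    and "\<And>x y. lip0_apply f x - lip0_apply f y = g x - g y"
proof
  let ?h = "\<lambda>x. g x - g base_point"
  have "1-lipschitz_on UNIV ?h"
    using g by (simp add: lipschitz_on_def dist_real_def)
  then have f: "lip0_apply (Lip0 ?h) = ?h" by (intro Lip0_inverse) auto
  show "lip0_apply (Lip0 ?h) x - lip0_apply (Lip0 ?h) y = g x - g y" for x y
    by (simp add: f)
  have "lip_norm ?h \<le> 1"
    by (rule lip_norm_least) (use lipschitz_onD[OF g] in \<open>auto simp: dist_real_def\<close>)
  then show "norm (Lip0 ?h) \<le> 1" by (simp add: norm_lip0.rep_eq f)
qed

lemma subspace_closure:
  fixes S :: "'b::real_normed_vector set"
  assumes "subspace S"
  shows "subspace (closure S)"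
proof (rule subspaceI)
  show "0 \<in> closure S" using subspace_0[OF assms] closure_subset by blast
  fix x y :: 'b and c :: real
  assume "x \<in> closure S"
  then obtain a where a: "\<And>n. a n \<in> S" "a \<longlonglongrightarrow> x" unfolding closure_sequential by blast
  have "(\<lambda>n. c *\<^sub>R a n) \<longlonglongrightarrow> c *\<^sub>R x" by (intro tendsto_intros a)
  moreover have "c *\<^sub>R a n \<in> S" for n by (rule subspace_scale[OF assms a(1)])
  ultimately show "c *\<^sub>R x \<in> closure S"
    unfolding closure_sequential by (intro exI[of _ "\<lambda>n. c *\<^sub>R a n"]) blast
  assume "y \<in> closure S"
  then obtain b where b: "\<And>n. b n \<in> S" "b \<longlonglongrightarrow> y" unfolding closure_sequential by blast
  have "(\<lambda>n. a n + b n) \<longlonglongrightarrow> x + y" by (intro tendsto_intros a b)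
  moreover have "a n + b n \<in> S" for n by (rule subspace_add[OF assms a(1) b(1)])
  ultimately show "x + y \<in> closure S"
    unfolding closure_sequential by (intro exI[of _ "\<lambda>n. a n + b n"]) blast
qed

lemma lipschitz_free_closed_subspace: "subspace lipschitz_free" "closed lipschitz_free"
  unfolding lipschitz_free_def by (simp_all add: subspace_closure)

lemma lip0_eval_in_lipschitz_free: "lip0_eval x \<in> lipschitz_free"
  unfolding lipschitz_free_def by (rule subsetD[OF closure_subset]) (simp add: span_base)

section \<open>Molecules of nearly touching balls\<close>

text \<open>The balls with centres \<open>z i\<close> and radii \<open>R i\<close> are disjoint in the strong sense that the
  radii of any two add up to at most the distance of the centres, while for the partners with
  indices \<open>2 * n\<close> and \<open>2 * n + 1\<close> they add up to almost that distance: they nearly touch.\<close>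
definition paired_balls ::
    "(nat \<Rightarrow> real) \<Rightarrow> (nat \<Rightarrow> 'a::metric_space) \<Rightarrow> (nat \<Rightarrow> real) \<Rightarrow> bool" where
  "paired_balls e z R \<longleftrightarrow> (\<forall>i. 0 < R i) \<and> (\<forall>i j. i \<noteq> j \<longrightarrow> R i + R j \<le> dist (z i) (z j)) \<and>
    (\<forall>n. (1 - e n) * dist (z (2 * n)) (z (2 * n + 1)) \<le> R (2 * n) + R (2 * n + 1))"

text \<open>Any function with \<open>\<bar>f (z i)\<bar> \<le> R i\<close> is 1-Lipschitz on the centres, whatever the signs of its
  values. This freedom lets one function norm all the molecules of the partner pairs
  simultaneously, with prescribed signs, and is what produces \<open>\<ell>\<^sub>1\<close>.\<close>
lemma paired_balls_sign_functional:
  fixes z :: "nat \<Rightarrow> 'a::pointed_metric_space"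
  assumes b: "paired_balls e z R" and \<sigma>: "\<And>n. \<bar>\<sigma> n\<bar> \<le> 1"
  obtains f :: "'a lip0" where "norm f \<le> 1"
    and "\<And>n. lip0_apply f (z (2 * n)) - lip0_apply f (z (2 * n + 1))
              = \<sigma> n * (R (2 * n) + R (2 * n + 1))"
proof -
  have R: "0 < R i" and sep: "i \<noteq> j \<Longrightarrow> R i + R j \<le> dist (z i) (z j)" for i j
    using b by (auto simp: paired_balls_def)
  have "inj z"
  proof (rule injI, rule ccontr)
    fix i j assume "z i = z j" "i \<noteq> j"
    with sep[of i j] R[of i] R[of j] show False by simp
  qed
  define s where "s i = (if even i then 1 else - 1) * \<sigma> (i div 2) * R i" for i
  have s: "\<bar>s i\<bar> \<le> R i" for i
    using mult_right_mono[OF \<sigma>[of "i div 2"], of "R i"] R[of i] by (auto simp: s_def abs_mult)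
  have "1-lipschitz_on (range z) (\<lambda>x. s (inv z x))"
  proof (rule lipschitz_onI)
    fix x y assume "x \<in> range z" "y \<in> range z"
    then obtain i j where "x = z i" "y = z j" by blast
    then show "dist (s (inv z x)) (s (inv z y)) \<le> 1 * dist x y"
      using sep[of i j] s[of i] s[of j] \<open>inj z\<close> by (cases "i = j") (auto simp: dist_real_def)
  qed simp
  then obtain g where g: "1-lipschitz_on UNIV g"
    and g_eq: "\<And>x. x \<in> range z \<Longrightarrow> g x = s (inv z x)"
    by (rule mcshane_extension) blast
  from lip0_of_lipschitz[OF g] obtain f :: "'a lip0" where "norm f \<le> 1"
    and f: "\<And>x y. lip0_apply f x - lip0_apply f y = g x - g y" by blast
  moreover have "g (z (2 * n)) - g (z (2 * n + 1)) = \<sigma> n * (R (2 * n) + R (2 * n + 1))" for n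
    using g_eq \<open>inj z\<close> by (simp add: s_def distrib_left)
  ultimately show thesis using that by simp
qed

text \<open>The molecules of the partner pairs span an asymptotically isometric copy of \<open>\<ell>\<^sub>1\<close>: every
  sum with coefficients \<open>t\<close> has norm at most \<open>\<Sum>\<bar>t n\<bar>\<close> and at least \<open>\<Sum>(1 - e n) * \<bar>t n\<bar>\<close>.
  Multiplying the molecules by weights \<open>\<mu> n\<close> that decrease to 1 with
  \<open>\<mu> (Suc n) = (1 - e n) * \<mu> n\<close> turns this defect into a gain: shifting the index lowers the
  upper estimate for the norm to the lower estimate before the shift. The values of \<open>e\<close> below
  are the ones that belong to \<open>\<mu> n = (n + 2) / (n + 1)\<close>.\<close>
lemma paired_balls_imp_not_fixed_point_property:
  fixes z :: "nat \<Rightarrow> 'a::pointed_metric_space"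
  assumes b: "paired_balls (\<lambda>n. 1 / (real n + 2)\<^sup>2) z R"
  shows "\<not> fixed_point_property (lipschitz_free :: ('a lip0 \<Rightarrow>\<^sub>L real) set)"
proof -
  define d where "d n = dist (z (2 * n)) (z (2 * n + 1))" for n
  define \<mu> where "\<mu> n = (real n + 2) / (real n + 1)" for n
  define y where
    "y n = (\<mu> n / d n) *\<^sub>R (lip0_eval (z (2 * n)) - lip0_eval (z (2 * n + 1)))" for n
  have \<mu>: "1 \<le> \<mu> n" "\<mu> n \<le> 2" for n by (auto simp: \<mu>_def field_simps)
  have \<mu>_Suc: "\<mu> n * (1 - 1 / (real n + 2)\<^sup>2) = \<mu> (Suc n)" for n
    by (simp add: \<mu>_def divide_simps) (simp add: power2_eq_square algebra_simps)
  have d: "0 < d n" for n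
    using b[unfolded paired_balls_def] unfolding d_def
    by (metis add_pos_pos less_le_trans n_not_Suc_n Suc_eq_plus1)
  have norm_y: "norm (y n) \<le> \<mu> n" for n
  proof -
    have coeff: "0 < \<mu> n / d n" using \<mu>(1)[of n] d[of n] by simp
    have "norm (y n) \<le> (\<mu> n / d n) * d n"
      unfolding y_def norm_scaleR abs_of_nonneg[OF less_imp_le[OF coeff]]
      by (rule mult_left_mono) (use coeff in \<open>simp_all add: d_def norm_lip0_eval_diff_le\<close>)
    with d[of n] show ?thesis by simp
  qed
  have lower: "(\<Sum>k<N. \<bar>t k\<bar> * \<mu> (Suc k)) \<le> norm (\<Sum>k<N. t k *\<^sub>R y k)" for t N
  proof -
    \<comment> \<open>The functional attaches to the \<open>k\<close>-th molecule the sign of its coefficient.\<close>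
    obtain f :: "'a lip0" where f: "norm f \<le> 1"
      and f_eq: "\<And>n. lip0_apply f (z (2 * n)) - lip0_apply f (z (2 * n + 1))
              = sgn (t n) * (R (2 * n) + R (2 * n + 1))"
      by (rule paired_balls_sign_functional[OF b, of "\<lambda>n. sgn (t n)"])
        (auto simp: sgn_real_def)
    have "\<bar>t k\<bar> * \<mu> (Suc k) \<le> t k * blinfun_apply (y k) f" for k
    proof -
      have "\<mu> (Suc k) * d k = \<mu> k * ((1 - 1 / (real k + 2)\<^sup>2) * d k)"
        by (simp flip: \<mu>_Suc)
      also have "\<dots> \<le> \<mu> k * (R (2 * k) + R (2 * k + 1))"
        using b \<mu>[of k] by (intro mult_left_mono) (auto simp: paired_balls_def d_def)
      finally have "\<mu> (Suc k) \<le> \<mu> k / d k * (R (2 * k) + R (2 * k + 1))"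
        using d[of k] by (simp add: field_simps)
      then have "\<bar>t k\<bar> * \<mu> (Suc k) \<le> \<bar>t k\<bar> * (\<mu> k / d k * (R (2 * k) + R (2 * k + 1)))"
        by (rule mult_left_mono) simp
      also have "\<dots> = t k * blinfun_apply (y k) f"
        unfolding y_def blinfun.scaleR_left blinfun.diff_left lip0_eval_apply f_eq
        by (simp add: abs_sgn[of "t k"])
      finally show ?thesis .
    qed
    then have "(\<Sum>k<N. \<bar>t k\<bar> * \<mu> (Suc k)) \<le> (\<Sum>k<N. t k * blinfun_apply (y k) f)"
      by (rule sum_mono)
    also have "\<dots> = blinfun_apply (\<Sum>k<N. t k *\<^sub>R y k) f"
      by (simp add: blinfun.sum_left blinfun.scaleR_left)
    also have "\<dots> \<le> norm (\<Sum>k<N. t k *\<^sub>R y k) * norm f"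
      using norm_blinfun[of "\<Sum>k<N. t k *\<^sub>R y k" f] by simp
    also have "\<dots> \<le> norm (\<Sum>k<N. t k *\<^sub>R y k)"
      using mult_left_mono[OF f norm_ge_zero] by simp
    finally show ?thesis .
  qed
  show ?thesis
  proof (rule fixed_point_property_fails_by_shift[where y = y and K = 2 and c = 1])
    show "y k \<in> lipschitz_free" for k
      unfolding y_def by (intro subspace_scale subspace_diff lipschitz_free_closed_subspace
          lip0_eval_in_lipschitz_free)
    show "norm (y k) \<le> 2" for k using norm_y[of k] \<mu>[of k] by linarith
    fix t N
    have "(\<Sum>k<N. \<bar>t k\<bar>) \<le> (\<Sum>k<N. \<bar>t k\<bar> * \<mu> (Suc k))"
      using \<mu>(1) by (intro sum_mono) (simp add: mult_le_cancel_left1)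
    with lower[of t N] show "1 * (\<Sum>k<N. \<bar>t k\<bar>) \<le> norm (\<Sum>k<N. t k *\<^sub>R y k)" by linarith
    have "norm (\<Sum>k<N. t k *\<^sub>R y (Suc k)) \<le> (\<Sum>k<N. \<bar>t k\<bar> * \<mu> (Suc k))"
      by (rule sum_norm_le) (auto intro: mult_left_mono norm_y)
    with lower[of t N]
    show "norm (\<Sum>k<N. t k *\<^sub>R y (Suc k)) \<le> norm (\<Sum>k<N. t k *\<^sub>R y k)" by linarith
  qed (simp_all add: lipschitz_free_closed_subspace)
qed

section \<open>Nearly touching balls in infinite metric spaces\<close>

text \<open>Here \<open>\<phi>\<close> plays the role of the distance to a point that may lie outside the space. If of any
  two values of \<open>\<phi>\<close> one is much smaller than the other, then the distance of the two centres is
  essentially the larger value, so radii slightly smaller than \<open>\<phi>\<close> work. The disjunction in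
  the last hypothesis covers sequences receding from that point as well as sequences
  approaching it. The index \<open>i div 2\<close> is the number of the pair that contains \<open>i\<close>.\<close>
lemma paired_balls_lacunary:
  fixes z :: "nat \<Rightarrow> 'a::metric_space"
  assumes e: "\<And>n. 0 < e n" "\<And>n. e n \<le> 1"
    and pos: "\<And>i. 0 < \<phi> i"
    and lo: "\<And>i j. \<phi> i - \<phi> j \<le> dist (z i) (z j)"
    and up: "\<And>i j. i \<noteq> j \<Longrightarrow> dist (z i) (z j) \<le> \<phi> i + \<phi> j"
    and lac: "\<And>i j. i < j \<Longrightarrow> 2 * \<phi> j \<le> e (i div 2) / 2 * \<phi> i \<or> 2 * \<phi> i \<le> e (j div 2) / 2 * \<phi> j"
  shows "paired_balls e z (\<lambda>i. (1 - e (i div 2) / 2) * \<phi> i)"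
proof -
  let ?R = "\<lambda>i. (1 - e (i div 2) / 2) * \<phi> i"
  have half: "1 - e n / 2 > 0" for n using e[of n] by simp
  have R_pos: "0 < ?R i" for i using half pos by simp
  have R_le: "?R i \<le> \<phi> i" for i using e[of "i div 2"] pos[of i] by (simp add: mult_le_cancel_right2)
  \<comment> \<open>The amount by which the larger radius is shortened makes room for \<open>\<phi> j\<close> twice: once because
    the distance may be as small as \<open>\<phi> i - \<phi> j\<close>, once for the smaller ball.\<close>
  have dom: "?R i + ?R j \<le> dist (z i) (z j)" if "2 * \<phi> j \<le> e (i div 2) / 2 * \<phi> i" for i j
    using that lo[of i j] R_le[of j] by (simp add: algebra_simps)
  \<comment> \<open>For partners, the larger of the two radii already suffices.\<close>
  have touch: "(1 - e n) * (\<phi> i + \<phi> j) \<le> ?R i"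
    if "2 * \<phi> j \<le> e n / 2 * \<phi> i" "n = i div 2" for i j n
  proof -
    have "(1 - e n) * (\<phi> i + \<phi> j) \<le> (1 - e n) * (\<phi> i + e n / 4 * \<phi> i)"
      using that(1) e[of n] by (intro mult_left_mono) auto
    also have "\<dots> = ?R i - (e n / 4 + (e n)\<^sup>2 / 4) * \<phi> i"
      by (simp add: that(2) power2_eq_square field_simps)
    also have "\<dots> \<le> ?R i"
      using e[of n] pos[of i] by (simp add: zero_le_mult_iff add_nonneg_nonneg)
    finally show ?thesis .
  qed
  show ?thesis
    unfolding paired_balls_def
  proof (intro conjI allI impI)
    show "0 < ?R i" for i by (rule R_pos)
    fix i j :: nat assume "i \<noteq> j"
    then show "?R i + ?R j \<le> dist (z i) (z j)"
      using lac[of i j] lac[of j i] dom[of j i] dom[of i j] 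
      by (metis add.commute dist_commute linorder_neqE_nat)
  next
    fix n :: nat
    let ?i = "2 * n" and ?j = "2 * n + 1"
    have "(1 - e n) * dist (z ?i) (z ?j) \<le> (1 - e n) * (\<phi> ?i + \<phi> ?j)"
      using e[of n] by (intro mult_left_mono up) auto
    also have "\<dots> \<le> ?R ?i + ?R ?j"
      using lac[of ?i ?j] touch[of ?j n ?i] touch[of ?i n ?j] R_pos[of ?i] R_pos[of ?j]
      by (auto simp: add.commute)
    finally show "(1 - e n) * dist (z ?i) (z ?j) \<le> ?R ?i + ?R ?j" .
  qed
qed

text \<open>In an exactly equilateral set with side \<open>r\<close> the balls of radius \<open>r / 2\<close> touch pairwise. If the
  distances from \<open>z i\<close> to all later points are off by at most some amount, then reducing the
  radius at \<open>i\<close> by that amount keeps the balls disjoint.\<close>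
lemma paired_balls_almost_equilateral:
  fixes z :: "nat \<Rightarrow> 'a::metric_space"
  assumes e: "\<And>n. 0 < e n" "\<And>n. e n \<le> 1" and r: "0 < r"
    and eq: "\<And>i j. i < j \<Longrightarrow> \<bar>dist (z i) (z j) - r\<bar> \<le> r * e (i div 2) / 4"
  shows "paired_balls e z (\<lambda>i. r / 2 - r * e (i div 2) / 4)"
proof -
  have re: "0 < r * e n" "r * e n \<le> r" for n :: nat using e[of n] r by simp_all
  show ?thesis
    unfolding paired_balls_def
  proof (intro conjI allI impI)
    show "0 < r / 2 - r * e (i div 2) / 4" for i using re(2)[of "i div 2"] r by simp
    fix i j :: nat assume "i \<noteq> j"
    then show "r / 2 - r * e (i div 2) / 4 + (r / 2 - r * e (j div 2) / 4) \<le> dist (z i) (z j)"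
    proof (cases "i < j")
      case True
      then show ?thesis using eq[of i j] re(1)[of "j div 2"] by linarith
    next
      case False
      with \<open>i \<noteq> j\<close> show ?thesis
        using eq[of j i] re(1)[of "i div 2"] dist_commute[of "z i" "z j"] by linarith
    qed
  next
    fix n
    have "(1 - e n) * dist (z (2 * n)) (z (2 * n + 1)) \<le> (1 - e n) * (r + r * e n / 4)"
    proof (rule mult_left_mono)
      show "dist (z (2 * n)) (z (2 * n + 1)) \<le> r + r * e n / 4"
        using abs_le_D1[OF eq[of "2 * n" "2 * n + 1"]] by simp
    qed (use e(2) in simp)
    also have "\<dots> = r - r * e n / 2 - (r * e n / 4 + e n * (r * e n) / 4)"
      by (simp add: field_simps)
    also have "\<dots> \<le> r - r * e n / 2"
      using re(1)[of n] mult_pos_pos[OF e(1)[of n] re(1)[of n]] by linarith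
    finally show "(1 - e n) * dist (z (2 * n)) (z (2 * n + 1))
        \<le> r / 2 - r * e (2 * n div 2) / 4 + (r / 2 - r * e ((2 * n + 1) div 2) / 4)"
      by simp
  qed
qed

text \<open>Points whose distances to a given point \<open>p\<close> grow fast enough satisfy the hypotheses of
  \<open>paired_balls_lacunary\<close> with \<open>\<phi> i = dist p (z i)\<close>.\<close>
lemma paired_balls_unbounded:
  fixes e :: "nat \<Rightarrow> real"
  assumes unb: "\<not> bounded (UNIV :: 'a::metric_space set)"
    and e: "\<And>n. 0 < e n" "\<And>n. e n \<le> 1"
  obtains z :: "nat \<Rightarrow> 'a::metric_space" and R where "paired_balls e z R"
proof -
  fix p :: 'a
  have far: "\<exists>x. B \<le> dist p x" for B
    using unb by (force simp: bounded_def not_le intro: less_imp_le)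
  have "\<exists>z. \<forall>n. 0 < dist p (z n) \<and>
      2 * dist p (z n) \<le> e (Suc n div 2) / 2 * dist p (z (Suc n))"
  proof (rule dependent_nat_choice)
    show "\<exists>x. 0 < dist p x" using far[of 1] zero_less_one less_le_trans by blast
    fix x n assume x: "0 < dist p x"
    obtain y where y: "4 * dist p x / e (Suc n div 2) \<le> dist p y" using far by blast
    have "0 < 4 * dist p x / e (Suc n div 2)" using x e by simp
    with y e(1)[of "Suc n div 2"]
    show "\<exists>y. 0 < dist p y \<and> 2 * dist p x \<le> e (Suc n div 2) / 2 * dist p y"
      by (intro exI[of _ y]) (auto simp: divide_le_eq mult.commute)
  qed
  then obtain z where pos: "\<And>n. 0 < dist p (z n)"
    and step: "\<And>n. 2 * dist p (z n) \<le> e (Suc n div 2) / 2 * dist p (z (Suc n))" by blast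
  have "incseq (\<lambda>n. dist p (z n))"
  proof (rule incseq_SucI)
    fix n
    have "e (Suc n div 2) / 2 * dist p (z (Suc n)) \<le> 1 * dist p (z (Suc n))"
      using e(2)[of "Suc n div 2"] by (intro mult_right_mono) auto
    with step[of n] pos[of n] show "dist p (z n) \<le> dist p (z (Suc n))" by linarith
  qed
  then have lac: "2 * dist p (z i) \<le> e (j div 2) / 2 * dist p (z j)" if "i < j" for i j
    using step[of "j - 1"] that incseqD[of _ i "j - 1"] by fastforce
  have "paired_balls e z (\<lambda>i. (1 - e (i div 2) / 2) * dist p (z i))"
  proof (rule paired_balls_lacunary[OF e pos])
    show "dist p (z i) - dist p (z j) \<le> dist (z i) (z j)" for i j
      using dist_triangle[of p "z i" "z j"] by (simp add: dist_commute)
    show "dist (z i) (z j) \<le> dist p (z i) + dist p (z j)" for i j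
      by (rule dist_triangle3)
  qed (use lac in blast)
  then show thesis by (rule that)
qed

text \<open>Regard \<open>w k\<close> as the function \<open>m \<mapsto> dist (w m) (w k)\<close>. These functions lie in a countable power
  of a compact interval, which is compact and metrizable, so along a subsequence they converge
  pointwise to a limit \<open>\<rho>\<close>; a further subsequence makes \<open>\<rho>\<close> itself converge. The number \<open>\<rho> n\<close> is the
  distance from the \<open>n\<close>-th point to an ideal limit of the sequence.\<close>
lemma bounded_sequence_distances_converge:
  fixes w :: "nat \<Rightarrow> 'a::metric_space"
  assumes "bounded (range w)"
  obtains h :: "nat \<Rightarrow> nat" and \<rho> r where "strict_mono h"
    and "\<And>n. (\<lambda>k. dist (w (h n)) (w (h k))) \<longlonglongrightarrow> \<rho> n" and "\<rho> \<longlonglongrightarrow> r"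
proof -
  obtain D where D: "\<And>m n. dist (w m) (w n) \<le> D"
    using assms unfolding bounded_two_points by blast
  have "compactin (product_topology (\<lambda>_::nat. euclidean) UNIV) (PiE UNIV (\<lambda>_. {0..D}))"
    by (simp add: compactin_PiE)
  then have "compact (PiE UNIV (\<lambda>_::nat. {0..D}))"
    by (simp add: euclidean_product_topology)
  then have "seq_compact (PiE UNIV (\<lambda>_::nat. {0..D}))"
    by (simp add: compact_eq_seq_compact_metric)
  moreover have "(\<lambda>m. dist (w m) (w k)) \<in> PiE UNIV (\<lambda>_. {0..D})" for k
    using D by auto
  ultimately obtain f s where s: "strict_mono s"
    and lim: "((\<lambda>k m. dist (w m) (w k)) \<circ> s) \<longlonglongrightarrow> f" and fD: "f \<in> PiE UNIV (\<lambda>_. {0..D})"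
    using seq_compactE[of _ "\<lambda>k m. dist (w m) (w k)"] by metis
  have lim': "(\<lambda>k. dist (w m) (w (s k))) \<longlonglongrightarrow> f m" for m
    using continuous_on_tendsto_compose[OF continuous_on_product_coordinates[of m] lim]
    by (simp add: o_def)
  have D_compact: "seq_compact {0..D}" by (simp add: compact_imp_seq_compact)
  have "\<forall>n. f (s n) \<in> {0..D}" using fD by auto
  then obtain r s' where s': "strict_mono s'" and r: "((\<lambda>n. f (s n)) \<circ> s') \<longlonglongrightarrow> r"
    by (rule seq_compactE[OF D_compact])
  show thesis
  proof (rule that)
    show "strict_mono (s \<circ> s')" using s s' by (rule strict_mono_o)
    show "(\<lambda>k. dist (w ((s \<circ> s') n)) (w ((s \<circ> s') k))) \<longlonglongrightarrow> f ((s \<circ> s') n)" for n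
      using LIMSEQ_subseq_LIMSEQ[OF lim' s'] by (simp add: o_def)
    show "(\<lambda>n. f ((s \<circ> s') n)) \<longlonglongrightarrow> r" using r by (simp add: o_def)
  qed
qed

text \<open>With \<open>\<rho>\<close> and \<open>r\<close> as above there are two possibilities. If \<open>r = 0\<close>, then \<open>\<rho>\<close> has a lacunary
  subsequence: the points approach their ideal limit quickly. If \<open>r > 0\<close>, then the distance of two
  points with large indices is close to \<open>\<rho>\<close> at the first of them, hence to \<open>r\<close>, and a
  subsequence is almost equilateral.\<close>
lemma paired_balls_bounded:
  fixes e :: "nat \<Rightarrow> real"
  assumes bdd: "bounded (UNIV :: 'a::metric_space set)" and inf: "infinite (UNIV :: 'a::metric_space set)"
    and e: "\<And>n. 0 < e n" "\<And>n. e n \<le> 1"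
  obtains z :: "nat \<Rightarrow> 'a::metric_space" and R where "paired_balls e z R"
proof -
  obtain w :: "nat \<Rightarrow> 'a" where w: "inj w"
    using infinite_countable_subset[OF inf] by blast
  obtain g \<rho> r where g: "strict_mono g"
    and lim_g: "\<And>n. (\<lambda>k. dist (w (g n)) (w (g k))) \<longlonglongrightarrow> \<rho> n" and r: "\<rho> \<longlonglongrightarrow> r"
    using bounded_sequence_distances_converge[OF bounded_subset[OF bdd]] by (metis subset_UNIV)
  define v where "v n = w (g n)" for n
  have v_neq: "v i \<noteq> v j" if "i \<noteq> j" for i j
    using that injD[OF w] strict_mono_eq[OF g] by (auto simp: v_def)
  have lim: "(\<lambda>k. dist (v n) (v k)) \<longlonglongrightarrow> \<rho> n" for n using lim_g by (simp add: v_def)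
  have \<rho>_lo: "\<rho> i - \<rho> j \<le> dist (v i) (v j)" for i j
  proof (rule LIMSEQ_le_const2[OF tendsto_diff[OF lim lim]])
    have "dist (v i) (v k) - dist (v j) (v k) \<le> dist (v i) (v j)" for k
      using dist_triangle[of "v i" "v k" "v j"] by simp
    then show "\<exists>N. \<forall>k\<ge>N. dist (v i) (v k) - dist (v j) (v k) \<le> dist (v i) (v j)" by blast
  qed
  have \<rho>_up: "dist (v i) (v j) \<le> \<rho> i + \<rho> j" for i j
    by (rule LIMSEQ_le_const[OF tendsto_add[OF lim lim]]) (use dist_triangle2 in blast)
  have \<rho>_nonneg: "0 \<le> \<rho> i" for i using \<rho>_up[of i i] by simp
  have "0 \<le> r" by (rule LIMSEQ_le_const[OF r]) (use \<rho>_nonneg in auto)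
  then consider "r = 0" | "0 < r" by linarith
  then show thesis
  proof cases
    case 1
    have small: "\<exists>n. 0 < \<rho> n \<and> \<rho> n < c" if "0 < c" for c
    proof -
      have "\<forall>\<^sub>F n in sequentially. \<rho> n < c"
        using order_tendstoD(2)[OF r] that 1 by simp
      then obtain N where N: "\<And>n. n \<ge> N \<Longrightarrow> \<rho> n < c" unfolding eventually_sequentially by blast
      \<comment> \<open>The limit \<open>\<rho>\<close> vanishes at one point at most, namely where the sequence meets its limit.\<close>
      have "0 < dist (v N) (v (Suc N))" using v_neq[of N "Suc N"] by simp
      with \<rho>_up[of N "Suc N"] have "0 < \<rho> N \<or> 0 < \<rho> (Suc N)" by linarith
      with N[of N] N[of "Suc N"] show ?thesis by auto
    qed
    have "\<exists>h. \<forall>n. 0 < \<rho> (h n) \<and> 2 * \<rho> (h (Suc n)) \<le> e (n div 2) / 2 * \<rho> (h n)"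
    proof (rule dependent_nat_choice)
      show "\<exists>x. 0 < \<rho> x" using small[of 1] by auto
      fix x n assume "0 < \<rho> x"
      with small[of "e (n div 2) / 4 * \<rho> x"] e(1)[of "n div 2"]
      show "\<exists>y. 0 < \<rho> y \<and> 2 * \<rho> y \<le> e (n div 2) / 2 * \<rho> x" by force
    qed
    then obtain h where pos: "\<And>n. 0 < \<rho> (h n)"
      and step: "\<And>n. 2 * \<rho> (h (Suc n)) \<le> e (n div 2) / 2 * \<rho> (h n)" by blast
    have dec: "decseq (\<lambda>n. \<rho> (h n))"
    proof (rule decseq_SucI)
      fix n
      have "e (n div 2) / 2 * \<rho> (h n) \<le> 1 * \<rho> (h n)"
        using e(2)[of "n div 2"] by (intro mult_right_mono \<rho>_nonneg) simp
      with step[of n] pos[of "Suc n"] show "\<rho> (h (Suc n)) \<le> \<rho> (h n)" by linarith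
    qed
    have lac: "2 * \<rho> (h j) \<le> e (i div 2) / 2 * \<rho> (h i)" if "i < j" for i j
      using step[of i] decseqD[OF dec, of "Suc i" j] that by simp
    have "paired_balls e (\<lambda>i. v (h i)) (\<lambda>i. (1 - e (i div 2) / 2) * \<rho> (h i))"
      by (rule paired_balls_lacunary[OF e pos \<rho>_lo \<rho>_up]) (use lac in blast)
    then show thesis by (rule that)
  next
    case 2
    \<comment> \<open>Half of the tolerance in the almost equilateral case: one half for \<open>dist\<close> against \<open>\<rho>\<close>, one for
      \<open>\<rho>\<close> against \<open>r\<close>.\<close>
    define \<eta> where "\<eta> n = r * e (n div 2) / 8" for n
    have \<eta>: "0 < \<eta> n" for n using 2 e by (simp add: \<eta>_def)
    have near: "\<exists>y\<ge>N. \<bar>\<rho> y - r\<bar> < \<eta> n" for n N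
    proof -
      obtain M where "\<And>k. k \<ge> M \<Longrightarrow> \<bar>\<rho> k - r\<bar> < \<eta> n"
        using LIMSEQ_D[OF r \<eta>[of n]] by auto
      then show ?thesis by (intro exI[of _ "max M N"]) auto
    qed
    \<comment> \<open>The estimate at stage \<open>n\<close> is required for all indices from \<open>h (Suc n)\<close> on, so that each choice
      depends on the preceding one only.\<close>
    have "\<exists>h. \<forall>n. \<bar>\<rho> (h n) - r\<bar> < \<eta> n \<and>
        (h n < h (Suc n) \<and> (\<forall>k\<ge>h (Suc n). \<bar>dist (v (h n)) (v k) - \<rho> (h n)\<bar> < \<eta> n))"
    proof (rule dependent_nat_choice)
      show "\<exists>x. \<bar>\<rho> x - r\<bar> < \<eta> 0" using near by blast
      fix x n
      obtain M where M: "\<And>k. k \<ge> M \<Longrightarrow> \<bar>dist (v x) (v k) - \<rho> x\<bar> < \<eta> n"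
        using LIMSEQ_D[OF lim \<eta>[of n]] by auto
      obtain y where "max M (Suc x) \<le> y" "\<bar>\<rho> y - r\<bar> < \<eta> (Suc n)" using near by blast
      with M show "\<exists>y. \<bar>\<rho> y - r\<bar> < \<eta> (Suc n) \<and>
          (x < y \<and> (\<forall>k\<ge>y. \<bar>dist (v x) (v k) - \<rho> x\<bar> < \<eta> n))"
        by (intro exI[of _ y]) auto
    qed
    then obtain h where h1: "\<And>n. \<bar>\<rho> (h n) - r\<bar> < \<eta> n" and h_mono: "\<And>n. h n < h (Suc n)"
      and h2: "\<And>n k. k \<ge> h (Suc n) \<Longrightarrow> \<bar>dist (v (h n)) (v k) - \<rho> (h n)\<bar> < \<eta> n" by blast
    have "\<bar>dist (v (h i)) (v (h j)) - r\<bar> \<le> r * e (i div 2) / 4" if "i < j" for i j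
    proof -
      have "h (Suc i) \<le> h j"
        by (rule lift_Suc_mono_le[of h]) (use that h_mono less_imp_le in auto)
      from h2[OF this] h1[of i] have "\<bar>dist (v (h i)) (v (h j)) - r\<bar> \<le> 2 * \<eta> i" by linarith
      then show ?thesis by (simp add: \<eta>_def)
    qed
    then have "paired_balls e (\<lambda>i. v (h i)) (\<lambda>i. r / 2 - r * e (i div 2) / 4)"
      by (rule paired_balls_almost_equilateral[OF e 2])
    then show thesis by (rule that)
  qed
qed

theorem corollary6:
  assumes "infinite (UNIV :: 'a::pointed_metric_space set)"
  shows "\<not> fixed_point_property (lipschitz_free :: ('a lip0 \<Rightarrow>\<^sub>L real) set)"
proof -
  let ?e = "\<lambda>n. 1 / (real n + 2)\<^sup>2"
  have "1 \<le> (real n + 2)\<^sup>2" for n by (rule one_le_power) simp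
  then have e: "0 < ?e n" "?e n \<le> 1" for n by simp_all
  obtain z :: "nat \<Rightarrow> 'a" and R where "paired_balls ?e z R"
    using paired_balls_unbounded[where e = ?e, OF _ e] paired_balls_bounded[where e = ?e, OF _ assms e]
    by metis
  then show ?thesis by (rule paired_balls_imp_not_fixed_point_property)
qed

end
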